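(* Consider the optimization problem $$f_*=\min\{f(y):Ay=b,\ g(y)\le0,\ y\in Y\}$$ with optimal value $f_*$ and assume: (i) $Y\subset\mathbb{R}^n$ is a closed convex set and $A$ is a $q\times n$ matrix; (ii) $f:Y\to\mathbb{R}$ is convex and Lipschitz continuous with Lipschitz constant $L(f)$; (iii) $g:Y\to\mathbb{R}^p$, where all components of $g$ are convex Lipschitz continuous functions with Lipschitz constant $L(g)$; (iv) $f$ is bounded from below on the feasible set; (SL) there exist $\kappa>0$ and $y_0\in\mathrm{ri}(Y)$ such that $g(y_0)\le-\kappa\mathbf{e}$ and $Ay_0=b$, where $\mathbf{e}$ is the vector of ones in $\mathbb{R}^p$. Let $(\lambda(\varepsilon),\mu(\varepsilon))$ be an $\varepsilon$-optimal solution of the dual problem $$\max_{\lambda,\mu}\{\theta(\lambda,\mu):\mu\ge0,\ \lambda=Ay-b,\ y\in\mathrm{Aff}(Y)\},\qquad\theta(\lambda,\mu)=\min_{y\in Y}\{f(y)+\langle\lambda,Ay-b\rangle+\langle\mu,g(y)\rangle\},$$ whose optimal value is $f_*$. Let $r$ satisfy $0<r\le\frac{\kappa}{2L(g)}$ and be such that $\mathbb{B}_n(y_0,r)\cap\mathrm{Aff}(Y)\subseteq Y$ (such $r$ exists because $y_0\in\mathrm{ri}(Y)$). If $A=0$ let $\rho_*=1$; otherwise let $\rho_*$ be as defined in the context. Let $\mathcal{L}$ be any lower bound on $f_*$. Then $$\|(\lambda(\varepsilon),\mu(\varepsilon))\|\le\frac{f(y_0)-\mathcal{L}+\varepsilo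n+L(f)r}{\min(\rho_*,\kappa/2)}.$$
   Context: $\|\cdot\|$ is the Euclidean norm, $\mathbb{B}_n(x,r)$ is the closed Euclidean ball of center $x$ and radius $r$ in $\mathbb{R}^n$, $\mathrm{ri}$ denotes the relative interior, and $\mathrm{Aff}(Y)$ is the affine span of $Y$. An $\varepsilon$-optimal solution of the dual problem is a feasible $(\lambda,\mu)$ with $\theta(\lambda,\mu)\ge f_*-\varepsilon$. Let $V_Y=\{x-y:x,y\in\mathrm{Aff}(Y)\}$, so that $A\,\mathrm{Aff}(Y)-b=AV_Y$. For $z\in A\,\mathrm{Aff}(Y)-b$ define $$\rho(z)=\max\{t\|z\|:t\ge0,\ tz\in A(\mathbb{B}_n(0,r)\cap V_Y)\},$$ and, for $A\ne0$, $$\rho_*=\min\{\rho(z):z\neq0,\ z\in A\,\mathrm{Aff}(Y)-b\}=\min\{\rho(z):\|z\|=1,\ z\in AV_Y\}.$$ *)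

theory Defs
  imports "HOL-Analysis.Analysis"
begin

text \<open>
  All optimal values are infima or suprema in \<^typ>\<open>ereal\<close>: the dual function may be
  \<open>-\<infinity>\<close>, and no attainment of the primal minimum is presupposed.
  The order on \<^typ>\<open>real ^ 'p\<close> is componentwise, and the norm on
  \<^typ>\<open>(real ^ 'q) \<times> (real ^ 'p)\<close> is the Euclidean one.
\<close>

definition feasible_set ::
  "(real ^ 'n) set \<Rightarrow> real ^ 'n ^ 'q \<Rightarrow> real ^ 'q \<Rightarrow> (real ^ 'n \<Rightarrow> real ^ 'p) \<Rightarrow> (real ^ 'n) set"
  where "feasible_set Y A b g = {y \<in> Y. A *v y = b \<and> g y \<le> 0}"

definition primal_value ::
  "(real ^ 'n) set \<Rightarrow> real ^ 'n ^ 'q \<Rightarrow> real ^ 'q \<Rightarrow> (real ^ 'n \<Rightarrow> real ^ 'p) \<Rightarrow>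
   (real ^ 'n \<Rightarrow> real) \<Rightarrow> ereal"
  where "primal_value Y A b g f = (INF y\<in>feasible_set Y A b g. ereal (f y))"

definition dual_function ::
  "(real ^ 'n) set \<Rightarrow> real ^ 'n ^ 'q \<Rightarrow> real ^ 'q \<Rightarrow> (real ^ 'n \<Rightarrow> real ^ 'p) \<Rightarrow>
   (real ^ 'n \<Rightarrow> real) \<Rightarrow> real ^ 'q \<Rightarrow> real ^ 'p \<Rightarrow> ereal"
  where "dual_function Y A b g f lam mu =
    (INF y\<in>Y. ereal (f y + lam \<bullet> (A *v y - b) + mu \<bullet> g y))"

definition shifted_image :: "(real ^ 'n) set \<Rightarrow> real ^ 'n ^ 'q \<Rightarrow> real ^ 'q \<Rightarrow> (real ^ 'q) set"
  where "shifted_image Y A b = {A *v y - b | y. y \<in> affine hull Y}"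

definition dual_feasible_set ::
  "(real ^ 'n) set \<Rightarrow> real ^ 'n ^ 'q \<Rightarrow> real ^ 'q \<Rightarrow> ((real ^ 'q) \<times> (real ^ 'p)) set"
  where "dual_feasible_set Y A b = {(lam, mu). mu \<ge> 0 \<and> lam \<in> shifted_image Y A b}"

definition dual_value ::
  "(real ^ 'n) set \<Rightarrow> real ^ 'n ^ 'q \<Rightarrow> real ^ 'q \<Rightarrow> (real ^ 'n \<Rightarrow> real ^ 'p) \<Rightarrow>
   (real ^ 'n \<Rightarrow> real) \<Rightarrow> ereal"
  where "dual_value Y A b g f =
    (SUP (lam, mu)\<in>dual_feasible_set Y A b. dual_function Y A b g f lam mu)"

definition eps_optimal_dual ::
  "(real ^ 'n) set \<Rightarrow> real ^ 'n ^ 'q \<Rightarrow> real ^ 'q \<Rightarrow> (real ^ 'n \<Rightarrow> real ^ 'p) \<Rightarrow>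
   (real ^ 'n \<Rightarrow> real) \<Rightarrow> real \<Rightarrow> (real ^ 'q) \<times> (real ^ 'p) \<Rightarrow> bool"
  where "eps_optimal_dual Y A b g f eps = (\<lambda>(lam, mu).
    (lam, mu) \<in> dual_feasible_set Y A b \<and>
    dual_function Y A b g f lam mu \<ge> primal_value Y A b g f - ereal eps)"

definition direction_space :: "(real ^ 'n) set \<Rightarrow> (real ^ 'n) set"
  where "direction_space Y = {x - y | x y. x \<in> affine hull Y \<and> y \<in> affine hull Y}"

definition rho :: "(real ^ 'n) set \<Rightarrow> real ^ 'n ^ 'q \<Rightarrow> real \<Rightarrow> real ^ 'q \<Rightarrow> ereal"
  where "rho Y A r z =
    Sup {ereal (t * norm z) | t. t \<ge> 0 \<and> t *\<^sub>R z \<in> (*v) A ` (cball 0 r \<inter> direction_space Y)}"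

text \<open>
  If \<^term>\<open>A \<noteq> 0\<close> but \<^term>\<open>A\<close> vanishes on the direction space of \<^term>\<open>Y\<close>, the infimum below
  is over the empty set and equals \<open>\<infinity>\<close>.
\<close>

definition rho_star :: "(real ^ 'n) set \<Rightarrow> real ^ 'n ^ 'q \<Rightarrow> real ^ 'q \<Rightarrow> real \<Rightarrow> ereal"
  where "rho_star Y A b r =
    (if A = 0 then 1 else Inf {rho Y A r z | z. z \<noteq> 0 \<and> z \<in> shifted_image Y A b})"

end

theory Submission
  imports Defs
begin

text \<open>
  Both claims come from testing a Lagrangian lower bound at one point near the Slater point \<open>y0\<close>.
  Suppose \<open>c \<le> n * f y + \<lambda> \<bullet> (A y - b) + \<mu> \<bullet> g y\<close> for all \<open>y \<in> Y\<close>, with \<open>n, \<mu> \<ge> 0\<close>.  On the part of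
  \<open>Y\<close> within distance \<open>r\<close> of \<open>y0\<close> every constraint keeps the slack \<open>\<kappa> / 2\<close>, because
  \<open>Lg * r \<le> \<kappa> / 2\<close>.  If \<open>d\<close> is a direction of \<open>Aff Y\<close> of length at most \<open>r\<close> with \<open>A d = t \<lambda>\<close>, then
  \<open>y0 - d\<close> lies in that part and pushes the equality term down to \<open>- t \<parallel>\<lambda>\<parallel>\<^sup>2\<close>.  So
  \<open>t \<parallel>\<lambda>\<parallel>\<^sup>2 + (\<kappa> / 2) \<Sum> \<mu>\<^sub>i \<le> n * (f y0 + Lf * r) - c\<close>; this is
  \<open>lagrangian_bound_near_slater_point\<close>.

  Norm bound: take \<open>n = 1\<close> and \<open>c = Lb - \<epsilon>\<close>, which \<open>\<epsilon>\<close>-optimality provides, and let \<open>t \<parallel>\<lambda>\<parallel>\<close> approach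
  \<open>rho\<close> at \<open>\<lambda>\<close>, which is at least \<open>rho_star\<close>.

  Zero duality gap: the set of all \<open>(z, w, u)\<close> with \<open>z = A y - b\<close>, \<open>w \<ge> g y\<close> and \<open>u > f y - f\<^sub>*\<close> for some
  \<open>y \<in> Y\<close> is convex and misses the origin, so some nonzero \<open>(\<lambda>, \<mu>, n)\<close> is nonnegative on it.  This
  normal can be chosen in the span of the set, which places \<open>\<lambda>\<close> in the image under \<open>A\<close> of the
  directions of \<open>Aff Y\<close>, as dual feasibility demands.  If \<open>n = 0\<close>, the
  estimate with \<open>c = 0\<close> and some \<open>t > 0\<close> forces \<open>\<lambda> = 0\<close> and \<open>\<mu> = 0\<close>, a contradiction.  Hence \<open>n > 0\<close>,
  and dividing by \<open>n\<close> gives a dual solution of value \<open>f\<^sub>*\<close>.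
\<close>

section \<open>Directions of the affine hull\<close>

lemma direction_space_eq_translate:
  assumes "a \<in> affine hull Y"
  shows "direction_space Y = (\<lambda>x. - a + x) ` (affine hull Y)"
proof
  show "direction_space Y \<subseteq> (\<lambda>x. - a + x) ` (affine hull Y)"
  proof
    fix d assume "d \<in> direction_space Y"
    then obtain x y where xy: "d = x - y" "x \<in> affine hull Y" "y \<in> affine hull Y"
      by (auto simp: direction_space_def)
    have "a + 1 *\<^sub>R (x - y) \<in> affine hull Y"
      by (rule mem_affine_3_minus) (use assms xy in \<open>auto simp: affine_affine_hull\<close>)
    moreover have "d = - a + (a + 1 *\<^sub>R (x - y))" using xy by simp
    ultimately show "d \<in> (\<lambda>x. - a + x) ` (affine hull Y)" by blast
  qed
  show "(\<lambda>x. - a + x) ` (affine hull Y) \<subseteq> direction_space Y"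
    using assms unfolding direction_space_def by force
qed

lemma subspace_direction_space:
  assumes "Y \<noteq> {}"
  shows "subspace (direction_space Y)"
proof -
  obtain a where "a \<in> affine hull Y" using assms by (meson all_not_in_conv hull_inc)
  then show ?thesis
    using affine_diffs_subspace[OF affine_affine_hull] direction_space_eq_translate by metis
qed

lemma shifted_image_eq_image_direction_space:
  assumes "y0 \<in> Y" and "A *v y0 = b"
  shows "shifted_image Y A b = (*v) A ` direction_space Y"
proof -
  have "direction_space Y = (\<lambda>x. - y0 + x) ` (affine hull Y)"
    by (rule direction_space_eq_translate) (use assms in \<open>simp add: hull_inc\<close>)
  moreover have "A *v (- y0 + x) = A *v x - b" for x
    using assms(2) by (simp add: matrix_vector_mult_diff_distrib)
  ultimately show ?thesis by (auto simp: shifted_image_def image_image)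
qed

lemma positive_multiple_in_ball_image:
  fixes A :: "real ^ 'n ^ 'q"
  assumes "subspace V" and "z \<in> (*v) A ` V" and "0 < r"
  shows "\<exists>t>0. t *\<^sub>R z \<in> (*v) A ` (cball 0 r \<inter> V)"
proof -
  obtain v where v: "v \<in> V" "z = A *v v" using assms(2) by blast
  define t where "t = r / (1 + norm v)"
  have pos: "0 < t" using assms(3) by (simp add: t_def add_pos_nonneg)
  have "norm (t *\<^sub>R v) \<le> t * (1 + norm v)" using pos by simp
  also have "\<dots> = r" by (simp add: t_def add_nonneg_eq_0_iff)
  finally have "t *\<^sub>R v \<in> cball 0 r \<inter> V"
    using assms(1) v(1) by (simp add: subspace_scale)
  moreover have "t *\<^sub>R z = A *v (t *\<^sub>R v)" using v(2) by (simp add: matrix_vector_mult_scaleR)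
  ultimately show ?thesis using pos by blast
qed

section \<open>Lagrangian bounds tested near the Slater point\<close>

lemma lagrangian_bound_near_slater_point:
  fixes A :: "real ^ 'n ^ 'q" and g :: "real ^ 'n \<Rightarrow> real ^ 'p"
  assumes f: "Lf-lipschitz_on Y f" and g: "\<forall>i. Lg-lipschitz_on Y (\<lambda>y. g y $ i)"
    and slack: "Lg * r \<le> kappa / 2"
    and y0: "y0 \<in> Y" "A *v y0 = b" "g y0 \<le> - (kappa *\<^sub>R vec 1)"
    and ball: "cball y0 r \<inter> affine hull Y \<subseteq> Y"
    and mu: "0 \<le> mu" and n: "0 \<le> n"
    and bound: "\<And>y. y \<in> Y \<Longrightarrow> c \<le> n * f y + lam \<bullet> (A *v y - b) + mu \<bullet> g y"
    and t: "t *\<^sub>R lam \<in> (*v) A ` (cball 0 r \<inter> direction_space Y)"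
  shows "t * (norm lam)\<^sup>2 + kappa / 2 * (\<Sum>i\<in>UNIV. mu $ i) \<le> n * (f y0 + Lf * r) - c"
proof -
  obtain d where d: "norm d \<le> r" "d \<in> direction_space Y" "t *\<^sub>R lam = A *v d" using t by auto
  let ?y = "y0 - d"
  have "y0 \<in> affine hull Y" using y0(1) by (rule hull_inc)
  moreover have "- d \<in> direction_space Y"
    using subspace_direction_space[of Y] d(2) y0(1) by (metis empty_iff subspace_neg)
  ultimately obtain x where x: "- d = - y0 + x" "x \<in> affine hull Y"
    using direction_space_eq_translate by blast
  have "?y = y0 + - d" by simp
  also have "\<dots> = x" by (simp only: x(1)) simp
  finally have "?y \<in> affine hull Y" using x(2) by simp
  then have y: "?y \<in> Y" using ball d(1) by (auto simp: dist_norm)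
  have "dist (f ?y) (f y0) \<le> Lf * dist ?y y0" by (rule lipschitz_onD[OF f y y0(1)])
  also have "\<dots> \<le> Lf * r"
    using d(1) lipschitz_on_nonneg[OF f] by (auto simp: dist_norm intro: mult_left_mono)
  finally have fy: "f ?y \<le> f y0 + Lf * r" by (simp add: dist_real_def)
  have gy: "g ?y $ i \<le> - (kappa / 2)" for i
  proof -
    have "dist (g ?y $ i) (g y0 $ i) \<le> Lg * dist ?y y0"
      by (rule lipschitz_onD[OF spec[OF g] y y0(1)])
    also have "\<dots> \<le> Lg * r"
      using d(1) lipschitz_on_nonneg[OF spec[OF g]]
      by (auto simp: dist_norm intro: mult_left_mono)
    finally have "g ?y $ i \<le> g y0 $ i + Lg * r" by (simp add: dist_real_def)
    moreover have "g y0 $ i \<le> - kappa" using y0(3) by (simp add: less_eq_vec_def)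
    ultimately show ?thesis using slack by linarith
  qed
  have "mu \<bullet> g ?y = (\<Sum>i\<in>UNIV. mu $ i * g ?y $ i)" by (simp add: inner_vec_def)
  also have "\<dots> \<le> (\<Sum>i\<in>UNIV. mu $ i * - (kappa / 2))"
    using mu gy by (intro sum_mono mult_left_mono) (auto simp: less_eq_vec_def)
  also have "\<dots> = - (kappa / 2 * (\<Sum>i\<in>UNIV. mu $ i))"
    by (simp add: sum_distrib_left sum_negf mult.commute)
  finally have muy: "mu \<bullet> g ?y \<le> - (kappa / 2 * (\<Sum>i\<in>UNIV. mu $ i))" .
  have "A *v ?y - b = - (t *\<^sub>R lam)"
    using y0(2) d(3) by (simp add: matrix_vector_mult_diff_distrib)
  then have lamy: "lam \<bullet> (A *v ?y - b) = - (t * (norm lam)\<^sup>2)"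
    by (simp add: power2_norm_eq_inner)
  have "c \<le> n * f ?y + lam \<bullet> (A *v ?y - b) + mu \<bullet> g ?y" by (rule bound[OF y])
  also have "\<dots> \<le> n * (f y0 + Lf * r) - t * (norm lam)\<^sup>2 - kappa / 2 * (\<Sum>i\<in>UNIV. mu $ i)"
    using mult_left_mono[OF fy n] lamy muy by linarith
  finally show ?thesis by linarith
qed

lemma norm_le_sum_components:
  fixes mu :: "real ^ 'p"
  assumes "0 \<le> mu"
  shows "norm mu \<le> (\<Sum>i\<in>UNIV. mu $ i)"
  using norm_le_l1_cart[of mu] assms by (simp add: less_eq_vec_def)

section \<open>Zero duality gap\<close>

lemma dual_function_le_primal_value:
  assumes "0 \<le> mu"
  shows "dual_function Y A b g f lam mu \<le> primal_value Y A b g f"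
  unfolding primal_value_def
proof (rule INF_greatest)
  fix y assume "y \<in> feasible_set Y A b g"
  then have y: "y \<in> Y" "A *v y = b" "g y \<le> 0" by (auto simp: feasible_set_def)
  have "mu \<bullet> g y \<le> 0"
    using assms y(3) by (auto simp: inner_vec_def less_eq_vec_def intro!: sum_nonpos mult_nonneg_nonpos)
  then have "f y + lam \<bullet> (A *v y - b) + mu \<bullet> g y \<le> f y" using y by simp
  then show "dual_function Y A b g f lam mu \<le> ereal (f y)"
    unfolding dual_function_def using y(1) by (intro INF_lower2[of y]) auto
qed

lemma nonneg_if_affine_nonneg:
  fixes x k :: real
  assumes "\<And>t. 0 < t \<Longrightarrow> 0 \<le> x + t * k"
  shows "0 \<le> x" and "0 \<le> k"
proof -
  show "0 \<le> k"
  proof (rule ccontr)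
    assume "\<not> 0 \<le> k"
    \<comment> \<open>The value at this \<open>t\<close> is \<open>x - (\<bar>x\<bar> + 1) < 0\<close>.\<close>
    then have "(\<bar>x\<bar> + 1) / - k * k = - (\<bar>x\<bar> + 1)" "0 < (\<bar>x\<bar> + 1) / - k"
      by (auto simp: divide_pos_neg)
    then show False using assms[of "(\<bar>x\<bar> + 1) / - k"] by linarith
  qed
  show "0 \<le> x"
  proof (rule ccontr)
    assume neg: "\<not> 0 \<le> x"
    \<comment> \<open>Adding 1 to the denominator keeps \<open>t\<close> well defined when \<open>k = 0\<close>.\<close>
    have "- x * k < - x * (k + 1)" using neg by simp
    then have "- x / (k + 1) * k < - x" using \<open>0 \<le> k\<close> by (simp add: field_simps)
    moreover have "0 < - x / (k + 1)" using neg \<open>0 \<le> k\<close> by (intro divide_pos_pos) auto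
    ultimately show False using assms[of "- x / (k + 1)"] by linarith
  qed
qed

text \<open>
  The third inequality is strict so that the origin stays outside the set even when \<open>p\<close> is an attained
  minimum of \<open>f\<close> over the feasible points.
\<close>

definition lagrange_set ::
  "(real ^ 'n) set \<Rightarrow> real ^ 'n ^ 'q \<Rightarrow> real ^ 'q \<Rightarrow> (real ^ 'n \<Rightarrow> real ^ 'p) \<Rightarrow>
   (real ^ 'n \<Rightarrow> real) \<Rightarrow> real \<Rightarrow> ((real ^ 'q) \<times> (real ^ 'p) \<times> real) set"
  where "lagrange_set Y A b g f p =
    {(A *v y - b, w, u) | y w u. y \<in> Y \<and> g y \<le> w \<and> f y - p < u}"

lemma convex_lagrange_set:
  fixes A :: "real ^ 'n ^ 'q" and g :: "real ^ 'n \<Rightarrow> real ^ 'p"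
  assumes "convex_on Y f" and "\<forall>i. convex_on Y (\<lambda>y. g y $ i)"
  shows "convex (lagrange_set Y A b g f p)"
proof (rule convexI)
  fix x1 x2 :: "(real ^ 'q) \<times> (real ^ 'p) \<times> real" and s t :: real
  assume x: "x1 \<in> lagrange_set Y A b g f p" "x2 \<in> lagrange_set Y A b g f p"
    and st: "0 \<le> s" "0 \<le> t" "s + t = 1"
  obtain y w u where x1: "x1 = (A *v y - b, w, u)" "y \<in> Y" "g y \<le> w" "f y - p < u"
    using x(1) by (auto simp: lagrange_set_def)
  obtain y' w' u' where x2: "x2 = (A *v y' - b, w', u')" "y' \<in> Y" "g y' \<le> w'" "f y' - p < u'"
    using x(2) by (auto simp: lagrange_set_def)
  let ?y = "s *\<^sub>R y + t *\<^sub>R y'"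
  have Y: "?y \<in> Y" using assms(1) st x1(2) x2(2) by (auto simp: convex_on_def convex_def)
  have "g ?y $ i \<le> (s *\<^sub>R w + t *\<^sub>R w') $ i" for i
  proof -
    have "g ?y $ i \<le> s * g y $ i + t * g y' $ i"
      using assms(2) st x1(2) x2(2) by (auto simp: convex_on_def)
    also have "\<dots> \<le> s * w $ i + t * w' $ i"
      using st x1(3) x2(3) by (intro add_mono mult_left_mono) (auto simp: less_eq_vec_def)
    finally show ?thesis by simp
  qed
  then have gY: "g ?y \<le> s *\<^sub>R w + t *\<^sub>R w'" by (simp add: less_eq_vec_def)
  have "f ?y - p \<le> s * f y + t * f y' - (s + t) * p"
    using assms(1) st x1(2) x2(2) by (auto simp: convex_on_def)
  also have "\<dots> = s * (f y - p) + t * (f y' - p)" by (simp add: algebra_simps)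
  also have "\<dots> < s * u + t * u'"
  proof (cases "s = 0")
    case True
    then show ?thesis using st x2(4) by simp
  next
    case False
    then have "s * (f y - p) < s * u" using st x1(4) by simp
    moreover have "t * (f y' - p) \<le> t * u'" using st x2(4) by (simp add: mult_left_mono)
    ultimately show ?thesis by linarith
  qed
  finally have fY: "f ?y - p < s * u + t * u'" .
  have "b = s *\<^sub>R b + t *\<^sub>R b" using st(3) by (metis scaleR_add_left scaleR_one)
  then have "s *\<^sub>R (A *v y - b) + t *\<^sub>R (A *v y' - b) = A *v ?y - b"
    by (simp add: matrix_vector_right_distrib matrix_vector_mult_scaleR algebra_simps)
  then have "s *\<^sub>R x1 + t *\<^sub>R x2 = (A *v ?y - b, s *\<^sub>R w + t *\<^sub>R w', s * u + t * u')"
    by (simp add: x1(1) x2(1))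
  then show "s *\<^sub>R x1 + t *\<^sub>R x2 \<in> lagrange_set Y A b g f p"
    unfolding lagrange_set_def using Y gY fY by blast
qed

text \<open>
  Fritz John multipliers: every feasible point having value at least \<open>p\<close> means that the Lagrange set
  misses the origin.  A separating normal is taken in the span of that set, since this places its
  first component in the shifted image; an arbitrary normal need not have that property.
\<close>

lemma fritz_john_multipliers:
  fixes A :: "real ^ 'n ^ 'q" and g :: "real ^ 'n \<Rightarrow> real ^ 'p"
  assumes convex: "convex_on Y f" "\<forall>i. convex_on Y (\<lambda>y. g y $ i)"
    and y0: "y0 \<in> Y" "A *v y0 = b"
    and p: "\<And>y. y \<in> feasible_set Y A b g \<Longrightarrow> p \<le> f y"
  obtains lam mu n where "(lam, mu, n) \<noteq> 0" and "lam \<in> shifted_image Y A b" and "0 \<le> mu"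
    and "0 \<le> n" and "\<And>y. y \<in> Y \<Longrightarrow> n * p \<le> n * f y + lam \<bullet> (A *v y - b) + mu \<bullet> g y"
proof -
  let ?C = "lagrange_set Y A b g f p"
  have inC: "(A *v y - b, w, u) \<in> ?C" if "y \<in> Y" "g y \<le> w" "f y - p < u" for y w u
    using that unfolding lagrange_set_def by blast
  have "0 \<notin> ?C"
  proof
    assume "0 \<in> ?C"
    then obtain y where "y \<in> Y" "A *v y = b" "g y \<le> 0" "f y < p"
      by (auto simp: lagrange_set_def zero_prod_def)
    then show False using p[of y] by (simp add: feasible_set_def)
  qed
  moreover have "?C \<noteq> {}" using inC[of y0 "g y0" "f y0 - p + 1"] y0(1) by auto
  ultimately obtain a where a: "a \<in> span ?C" "a \<noteq> 0" "\<And>x. x \<in> ?C \<Longrightarrow> 0 \<le> a \<bullet> x"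
    using separating_hyperplane_set_0_inspan[OF convex_lagrange_set[OF convex]] by metis
  obtain lam mu n where eq: "a = (lam, mu, n)" by (cases a) auto
  have img: "shifted_image Y A b = (*v) A ` direction_space Y"
    by (rule shifted_image_eq_image_direction_space[OF y0])
  have "subspace (direction_space Y)" using y0(1) by (intro subspace_direction_space) auto
  then have "subspace (shifted_image Y A b)"
    unfolding img by (rule linear_subspace_image[OF matrix_vector_mul_linear])
  then have "subspace (shifted_image Y A b \<times> (UNIV :: ((real ^ 'p) \<times> real) set))"
    by (intro subspace_Times) auto
  moreover have "?C \<subseteq> shifted_image Y A b \<times> UNIV"
    by (auto simp: lagrange_set_def shifted_image_def intro: hull_inc)
  ultimately have lam: "lam \<in> shifted_image Y A b" using a(1) span_minimal eq by blast
  have sep: "0 \<le> lam \<bullet> (A *v y - b) + mu \<bullet> w + n * u" if "y \<in> Y" "g y \<le> w" "f y - p < u" for y w u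
    using a(3)[OF inC[OF that]] by (simp add: eq inner_Pair)
  \<comment> \<open>Letting \<open>u\<close> decrease to \<open>f y - p\<close> gives the Lagrangian bound, letting it grow gives \<open>0 \<le> n\<close>.\<close>
  have ray: "0 \<le> (lam \<bullet> (A *v y - b) + mu \<bullet> g y + n * (f y - p)) + t * n" if "y \<in> Y" "0 < t" for y t
    using sep[of y "g y" "f y - p + t"] that by (simp add: algebra_simps)
  have n: "0 \<le> n" by (rule nonneg_if_affine_nonneg(2)[OF ray[OF y0(1)]])
  have "0 \<le> mu $ i" for i
  proof (rule nonneg_if_affine_nonneg(2))
    fix t :: real assume "0 < t"
    then have "g y0 \<le> g y0 + t *\<^sub>R axis i 1" by (simp add: less_eq_vec_def axis_def)
    then show "0 \<le> (mu \<bullet> g y0 + n * (f y0 - p + 1)) + t * mu $ i"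
      using sep[of y0 "g y0 + t *\<^sub>R axis i 1" "f y0 - p + 1"] y0
      by (simp add: inner_add_right inner_axis algebra_simps)
  qed
  then have mu: "0 \<le> mu" by (simp add: less_eq_vec_def)
  have "n * p \<le> n * f y + lam \<bullet> (A *v y - b) + mu \<bullet> g y" if "y \<in> Y" for y
    using nonneg_if_affine_nonneg(1)[OF ray[OF that]] by (simp add: algebra_simps)
  with that[of lam mu n] a(2) eq lam mu n show thesis by blast
qed

text \<open>
  Slater's condition excludes \<open>n = 0\<close> among the Fritz John multipliers: \<open>lam \<bullet> (A y - b) + mu \<bullet> g y\<close>
  would then be nonnegative on \<open>Y\<close>, whereas moving from \<open>y0\<close> in a direction that \<open>A\<close> maps to a negative
  multiple of \<open>lam\<close> makes it negative unless \<open>lam\<close> and \<open>mu\<close> both vanish.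
\<close>

lemma strong_duality:
  fixes A :: "real ^ 'n ^ 'q" and g :: "real ^ 'n \<Rightarrow> real ^ 'p"
  assumes convex: "convex_on Y f" "\<forall>i. convex_on Y (\<lambda>y. g y $ i)"
    and f: "Lf-lipschitz_on Y f" and g: "\<forall>i. Lg-lipschitz_on Y (\<lambda>y. g y $ i)"
    and kappa: "0 < kappa" and r: "0 < r" and slack: "Lg * r \<le> kappa / 2"
    and y0: "y0 \<in> Y" "A *v y0 = b" "g y0 \<le> - (kappa *\<^sub>R vec 1)"
    and ball: "cball y0 r \<inter> affine hull Y \<subseteq> Y"
    and finite: "primal_value Y A b g f = ereal p"
  shows "dual_value Y A b g f = primal_value Y A b g f"
proof (rule antisym)
  show "dual_value Y A b g f \<le> primal_value Y A b g f"
    unfolding dual_value_def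
    by (rule SUP_least) (auto simp: dual_feasible_set_def intro: dual_function_le_primal_value)
  have p: "p \<le> f y" if "y \<in> feasible_set Y A b g" for y
    using finite that INF_lower[of y "feasible_set Y A b g" "\<lambda>y. ereal (f y)"]
    by (simp add: primal_value_def)
  obtain lam mu n where nz: "(lam, mu, n) \<noteq> 0" and lam: "lam \<in> shifted_image Y A b"
    and mu: "0 \<le> mu" and n: "0 \<le> n"
    and bound: "\<And>y. y \<in> Y \<Longrightarrow> n * p \<le> n * f y + lam \<bullet> (A *v y - b) + mu \<bullet> g y"
    using fritz_john_multipliers[OF convex y0(1,2) p] by metis
  have img: "shifted_image Y A b = (*v) A ` direction_space Y"
    by (rule shifted_image_eq_image_direction_space[OF y0(1,2)])
  have sub: "subspace (direction_space Y)" using y0(1) by (intro subspace_direction_space) auto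
  have "n \<noteq> 0"
  proof
    assume "n = 0"
    obtain t where t: "0 < t" "t *\<^sub>R lam \<in> (*v) A ` (cball 0 r \<inter> direction_space Y)"
      using positive_multiple_in_ball_image[OF sub _ r] lam img by metis
    have "t * (norm lam)\<^sup>2 + kappa / 2 * (\<Sum>i\<in>UNIV. mu $ i) \<le> n * (f y0 + Lf * r) - n * p"
      by (rule lagrangian_bound_near_slater_point[OF f g slack y0 ball mu n bound t(2)])
    moreover have "kappa / 2 * norm mu \<le> kappa / 2 * (\<Sum>i\<in>UNIV. mu $ i)"
      using kappa norm_le_sum_components[OF mu] by simp
    ultimately have "t * (norm lam)\<^sup>2 + kappa / 2 * norm mu \<le> 0" using \<open>n = 0\<close> by simp
    moreover have "0 \<le> t * (norm lam)\<^sup>2" "0 \<le> kappa / 2 * norm mu" using t(1) kappa by simp_all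
    ultimately have "t * (norm lam)\<^sup>2 = 0" "kappa / 2 * norm mu = 0" by linarith+
    then show False using nz t(1) kappa \<open>n = 0\<close> by (simp add: zero_prod_def)
  qed
  then have "0 < n" using n by simp
  let ?lam = "(1 / n) *\<^sub>R lam" and ?mu = "(1 / n) *\<^sub>R mu"
  have "subspace (shifted_image Y A b)"
    unfolding img by (rule linear_subspace_image[OF matrix_vector_mul_linear sub])
  then have "?lam \<in> shifted_image Y A b" using lam by (rule subspace_scale)
  moreover have "0 \<le> ?mu" using mu \<open>0 < n\<close> by (simp add: less_eq_vec_def)
  ultimately have feas: "(?lam, ?mu) \<in> dual_feasible_set Y A b" by (simp add: dual_feasible_set_def)
  have "ereal p \<le> dual_function Y A b g f ?lam ?mu"
    unfolding dual_function_def
  proof (rule INF_greatest)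
    fix y assume "y \<in> Y"
    from bound[OF this] have "p \<le> f y + ?lam \<bullet> (A *v y - b) + ?mu \<bullet> g y"
      using \<open>0 < n\<close> by (simp add: field_simps)
    then show "ereal p \<le> ereal (f y + ?lam \<bullet> (A *v y - b) + ?mu \<bullet> g y)" by simp
  qed
  also have "\<dots> \<le> dual_value Y A b g f"
    unfolding dual_value_def using feas by (intro SUP_upper2[of "(?lam, ?mu)"]) auto
  finally show "primal_value Y A b g f \<le> dual_value Y A b g f" using finite by simp
qed

section \<open>The multiplier bound\<close>

lemma rho_star_nonneg:
  assumes "0 \<le> r" and "Y \<noteq> {}"
  shows "0 \<le> rho_star Y A b r"
proof -
  have "0 \<in> cball 0 r \<inter> direction_space Y"
    using subspace_0[OF subspace_direction_space] assms by auto
  then have "0 \<in> (*v) A ` (cball 0 r \<inter> direction_space Y)"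
    by (metis image_eqI matrix_vector_mult_0_right)
  then have "0 \<le> rho Y A r z" for z
    unfolding rho_def by (intro Sup_upper2[of 0]) (auto intro!: exI[of _ 0] simp: zero_ereal_def)
  then show ?thesis unfolding rho_star_def by (auto intro!: Inf_greatest)
qed

text \<open>
  For \<open>A = 0\<close> the only element of \<open>shifted_image Y A b\<close> is 0, so \<open>lam \<noteq> 0\<close> rules out the case in which
  \<open>rho_star\<close> takes its conventional value 1.
\<close>

lemma rho_star_le:
  assumes "y0 \<in> Y" and "A *v y0 = b" and "lam \<in> shifted_image Y A b" and "lam \<noteq> 0"
  shows "rho_star Y A b r \<le> rho Y A r lam"
proof -
  have "A \<noteq> 0"
  proof
    assume "A = 0"
    then show False
      using assms unfolding shifted_image_eq_image_direction_space[OF assms(1,2)] by auto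
  qed
  then show ?thesis unfolding rho_star_def using assms by (auto intro!: Inf_lower)
qed

theorem proposition3p1:
  fixes Y :: "(real ^ 'n) set"
    and A :: "real ^ 'n ^ 'q"
    and b :: "real ^ 'q"
    and f :: "real ^ 'n \<Rightarrow> real"
    and g :: "real ^ 'n \<Rightarrow> real ^ 'p"
    and y0 :: "real ^ 'n"
    and lam :: "real ^ 'q"
    and mu :: "real ^ 'p"
    and Lf Lg kappa r eps Lb :: real
  assumes "closed Y" and "convex Y"
    and "convex_on Y f" and "Lf-lipschitz_on Y f"
    and "\<forall>i. convex_on Y (\<lambda>y. g y $ i)" and "\<forall>i. Lg-lipschitz_on Y (\<lambda>y. g y $ i)"
    and "bdd_below (f ` feasible_set Y A b g)"
    and "kappa > 0" and "y0 \<in> rel_interior Y"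
    and "g y0 \<le> - (kappa *\<^sub>R vec 1)" and "A *v y0 = b"
    and "eps_optimal_dual Y A b g f eps (lam, mu)"
    and "0 < r" and "ereal r \<le> ereal kappa / ereal (2 * Lg)"
    and "cball y0 r \<inter> affine hull Y \<subseteq> Y"
    and "ereal Lb \<le> primal_value Y A b g f"
  shows "dual_value Y A b g f = primal_value Y A b g f \<and>
    ereal (norm (lam, mu))
      \<le> ereal (f y0 - Lb + eps + Lf * r) / min (rho_star Y A b r) (ereal (kappa / 2))"
proof
  have y0: "y0 \<in> Y" using assms(9) rel_interior_subset by blast
  note A0 = assms(11) and gy0 = assms(10) and ball = assms(15)
  have slack: "Lg * r \<le> kappa / 2"
  proof (cases "Lg = 0")
    case True
    then show ?thesis using \<open>kappa > 0\<close> by simp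
  next
    case False
    moreover have "0 \<le> Lg" using assms(6) lipschitz_on_nonneg by blast
    ultimately show ?thesis using assms(14) by (simp add: field_simps)
  qed
  have "g y0 \<le> 0"
    using gy0 \<open>kappa > 0\<close> by (auto simp: less_eq_vec_def intro: order_trans)
  then have "y0 \<in> feasible_set Y A b g" using y0 A0 by (simp add: feasible_set_def)
  then have "primal_value Y A b g f \<le> ereal (f y0)"
    unfolding primal_value_def by (rule INF_lower)
  then obtain p where p: "primal_value Y A b g f = ereal p"
    using assms(16) by (cases "primal_value Y A b g f") auto
  show "dual_value Y A b g f = primal_value Y A b g f"
    by (rule strong_duality[OF assms(3,5,4,6,8,13) slack y0 A0 gy0 ball p])

  have lam: "lam \<in> shifted_image Y A b" and mu: "0 \<le> mu"
    and opt: "ereal p - ereal eps \<le> dual_function Y A b g f lam mu"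
    using assms(12) p by (auto simp: eps_optimal_dual_def dual_feasible_set_def)
  have "Lb \<le> p" using assms(16) p by simp
  have bound: "Lb - eps \<le> 1 * f y + lam \<bullet> (A *v y - b) + mu \<bullet> g y" if "y \<in> Y" for y
  proof -
    have "ereal p - ereal eps \<le> ereal (f y + lam \<bullet> (A *v y - b) + mu \<bullet> g y)"
      using opt INF_lower[OF that] unfolding dual_function_def by (rule order_trans)
    then show ?thesis using \<open>Lb \<le> p\<close> by simp
  qed
  define M where "M = f y0 - Lb + eps + Lf * r"
  have est: "t * (norm lam)\<^sup>2 + kappa / 2 * norm mu \<le> M"
    if "t *\<^sub>R lam \<in> (*v) A ` (cball 0 r \<inter> direction_space Y)" for t
  proof -
    have "t * (norm lam)\<^sup>2 + kappa / 2 * (\<Sum>i\<in>UNIV. mu $ i) \<le> 1 * (f y0 + Lf * r) - (Lb - eps)"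
      by (rule lagrangian_bound_near_slater_point
          [OF assms(4,6) slack y0 A0 gy0 ball mu zero_le_one bound that])
    moreover have "kappa / 2 * norm mu \<le> kappa / 2 * (\<Sum>i\<in>UNIV. mu $ i)"
      using \<open>kappa > 0\<close> norm_le_sum_components[OF mu] by simp
    ultimately show ?thesis by (simp add: M_def)
  qed
  have sub: "subspace (direction_space Y)" using y0 by (intro subspace_direction_space) auto
  obtain t where t: "0 < t" "t *\<^sub>R lam \<in> (*v) A ` (cball 0 r \<inter> direction_space Y)"
    using positive_multiple_in_ball_image[OF sub _ \<open>0 < r\<close>] lam
      shifted_image_eq_image_direction_space[OF y0 A0] by metis
  have nonneg: "0 \<le> t * (norm lam)\<^sup>2" "0 \<le> kappa / 2 * norm mu" using t(1) \<open>kappa > 0\<close> by simp_all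
  let ?m = "min (rho_star Y A b r) (ereal (kappa / 2))"
  have "0 \<le> ?m" using rho_star_nonneg[of r Y A b] \<open>0 < r\<close> \<open>kappa > 0\<close> y0 by auto
  moreover have "?m \<le> ereal (kappa / 2)" by simp
  ultimately obtain m where m: "?m = ereal m" "0 \<le> m" "m \<le> kappa / 2" by (cases ?m) auto
  have "m * norm lam + kappa / 2 * norm mu \<le> M"
  proof (cases "lam = 0")
    case True
    then show ?thesis using est[OF t(2)] by simp
  next
    case False
    have "ereal m \<le> rho Y A r lam"
      using rho_star_le[OF y0 A0 lam False, of r] m(1) by (metis min.cobounded1 order_trans)
    also have "\<dots> \<le> ereal ((M - kappa / 2 * norm mu) / norm lam)"
      unfolding rho_def
    proof (rule Sup_least)
      fix x assume "x \<in> {ereal (t * norm lam) | t.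
        t \<ge> 0 \<and> t *\<^sub>R lam \<in> (*v) A ` (cball 0 r \<inter> direction_space Y)}"
      then obtain t where x: "x = ereal (t * norm lam)"
        and t: "t *\<^sub>R lam \<in> (*v) A ` (cball 0 r \<inter> direction_space Y)"
        by blast
      from est[OF t] show "x \<le> ereal ((M - kappa / 2 * norm mu) / norm lam)"
        using False by (simp add: x field_simps power2_eq_square)
    qed
    finally show ?thesis using False by (simp add: field_simps)
  qed
  moreover have "m * norm mu \<le> kappa / 2 * norm mu"
    using m(3) by (rule mult_right_mono) simp
  moreover have "m * norm (lam, mu) \<le> m * (norm lam + norm mu)"
    by (rule mult_left_mono[OF norm_Pair_le m(2)])
  ultimately have main: "m * norm (lam, mu) \<le> M" by (simp add: distrib_left)
  have "ereal (norm (lam, mu)) \<le> ereal M / ereal m"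
  \<comment> \<open>For \<open>m = 0\<close> the quotient in the extended reals is \<open>\<infinity>\<close> if \<open>M > 0\<close>, but 0 if \<open>M = 0\<close>; in the latter
     case the estimate at a positive \<open>t\<close> makes both multipliers vanish.\<close>
  proof (cases "m = 0")
    case False
    then show ?thesis using main m(2) by (simp add: field_simps)
  next
    case True
    show ?thesis
    proof (cases "M = 0")
      case True
      then have "t * (norm lam)\<^sup>2 = 0" "kappa / 2 * norm mu = 0"
        using est[OF t(2)] nonneg by linarith+
      then have "(lam, mu) = 0" using t(1) \<open>kappa > 0\<close> by (simp add: zero_prod_def)
      then show ?thesis using True by simp
    next
      case False
      then have "0 < M" using est[OF t(2)] nonneg by linarith
      then show ?thesis using \<open>m = 0\<close> by (simp add: divide_ereal_def)
    qed
  qed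
  then show "ereal (norm (lam, mu))
      \<le> ereal (f y0 - Lb + eps + Lf * r) / min (rho_star Y A b r) (ereal (kappa / 2))"
    by (simp only: m(1) M_def)
qed

end
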